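(* Let $\mathcal H$ be a separable Hilbert space, let $\mathcal W_w=\{(\mathcal W_i,w_i)\}_{i\in I}$ be a fusion Bessel sequence in $\mathcal H$ with bound $B>0$, let $J\subsetneq I$, and let $T_{\mathcal W}$ be the synthesis operator associated with $\{(\mathcal W_i,w_i)\}_{i\in I\setminus J}$. Let $a,b\ge 0$ and let $K\in\mathcal L(\mathcal H)$ satisfy $$\|(K^*-T_{\mathcal W}T_{\mathcal W}^* )f\|\le a\|K^*f\|+b\|T_{\mathcal W}^*f\|\quad\text{for all } f\in\mathcal H.$$ If $a<1$, then $\{(\mathcal W_i,w_i)\}_{i\in I\setminus J}$ is a $K$-fusion frame for $\mathcal H$ with bounds $\left(\frac{1-a}{b+\|T_{\mathcal W}\|}\right)^2$ and $B$.
   Context: $\mathcal L(\mathcal H)$ is the space of bounded linear operators on $\mathcal H$. The index set $I$ is finite or countable. $P_{\mathcal W}$ is the orthogonal projection onto a closed subspace $\mathcal W$. A weighted collection $\{(\mathcal W_i,w_i)\}_{i\in I}$ consists of closed subspaces $\mathcal W_i$ of $\mathcal H$ and real scalars $w_i$. It is a fusion Bessel sequence with bound $B>0$ if $\sum_{i\in I}w_i^2\|P_{\mathcal W_i}f\|^2\le B\|f\|^2$ for all $f\in\mathcal H$. For $K\in\mathcal L(\mathcal H)$ it is a $K$-fusion frame for $\mathcal H$ with bounds $A,B>0$ if $A\|K^*f\|^2\le\sum_{i\in I}w_i^2\|P_{\mathcal W_i}f\|^2\le B\|f\|^2$ for all $f\in\mathcal H$ (likewise with $I$ replaced by $I\setminus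 J$). The synthesis operator associated with $\{(\mathcal W_i,w_i)\}_{i\in I\setminus J}$ is the bounded operator $T_{\mathcal W}:\left(\sum_{i\in I\setminus J}\bigoplus\mathcal W_i\right)_{l^2}\to\mathcal H$, $T_{\mathcal W}(\{f_i\})=\sum_{i\in I\setminus J}w_if_i$, where $\left(\sum_{i\in I\setminus J}\bigoplus\mathcal W_i\right)_{l^2}=\{\{f_i\}:f_i\in\mathcal W_i,\ \sum\|f_i\|^2<\infty\}$ with inner product $\langle\{f_i\},\{g_i\}\rangle=\sum\langle f_i,g_i\rangle$; its adjoint is $T_{\mathcal W}^*f=\{w_iP_{\mathcal W_i}f\}_{i\in I\setminus J}$. The expression for the lower bound presupposes $b+\|T_{\mathcal W}\|\neq 0$. *)

theory Defs
  imports "HOL-Analysis.Analysis"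
begin

text \<open>
  The scalar field is the reals or the complex numbers, with \<open>cj\<close> the conjugation. By the
  Gelfand--Mazur theorem these are the only real normed fields, and \<open>mult_cj\<close> determines \<open>cj\<close>.
\<close>

class rc_field = real_normed_field + banach +
  fixes cj :: "'a \<Rightarrow> 'a"
  assumes cj_add: "cj (x + y) = cj x + cj y"
    and mult_cj: "x * cj x = (norm x)\<^sup>2 *\<^sub>R 1"

instantiation real :: rc_field
begin
definition cj_real :: "real \<Rightarrow> real" where "cj_real x = x"
instance by standard (auto simp: cj_real_def power2_eq_square)
end

instantiation complex :: rc_field
begin
definition cj_complex :: "complex \<Rightarrow> complex" where "cj_complex = cnj"
instance
proof
  fix x y :: complex
  show "cj (x + y) = cj x + cj y" by (simp add: cj_complex_def)
  show "x * cj x = (norm x)\<^sup>2 *\<^sub>R 1"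
    unfolding cj_complex_def scaleR_conv_of_real by (simp only: complex_norm_square mult_1_right)
qed
end

text \<open>
  Completeness comes from the class \<open>banach\<close>; the norm and the real scalar multiplication of the
  type are required to be those induced by \<open>ip\<close> and \<open>sc\<close>.
\<close>

locale hilbert_space = vector_space sc
  for sc :: "'k::rc_field \<Rightarrow> 'h::banach \<Rightarrow> 'h" +
  fixes ip :: "'h \<Rightarrow> 'h \<Rightarrow> 'k"
  assumes sc_of_real: "sc (of_real r) x = r *\<^sub>R x"
    and ip_add_left: "ip (x + y) z = ip x z + ip y z"
    and ip_sc_left: "ip (sc c x) y = c * ip x y"
    and ip_commute: "ip y x = cj (ip x y)"
    and ip_self: "ip x x = of_real ((norm x)\<^sup>2)"

lemma hilbert_space_real_inner:
  "hilbert_space scaleR (inner :: 'a::{real_inner,banach} \<Rightarrow> 'a \<Rightarrow> real)"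
  by unfold_locales
    (auto simp: inner_add_left inner_commute cj_real_def power2_norm_eq_inner algebra_simps)

lemma hilbert_space_complex:
  "hilbert_space ((*) :: complex \<Rightarrow> complex \<Rightarrow> complex) (\<lambda>x y. x * cnj y)"
proof unfold_locales
  fix x :: complex
  show "x * cnj x = of_real ((norm x)\<^sup>2)" by (rule complex_norm_square [symmetric])
qed (simp_all add: cj_complex_def algebra_simps scaleR_conv_of_real)

definition bounded_operator ::
    "('k::rc_field \<Rightarrow> 'h::banach \<Rightarrow> 'h) \<Rightarrow> ('h \<Rightarrow> 'h) \<Rightarrow> bool" where
  "bounded_operator sc K \<longleftrightarrow>
     Vector_Spaces.linear sc sc K \<and> (\<exists>C. \<forall>x. norm (K x) \<le> C * norm x)"

definition adj :: "('h::banach \<Rightarrow> 'h \<Rightarrow> 'k::rc_field) \<Rightarrow> ('h \<Rightarrow> 'h) \<Rightarrow> 'h \<Rightarrow> 'h" where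
  "adj ip K f = (THE g. \<forall>x. ip (K x) f = ip x g)"

definition closed_subspace ::
    "('k::rc_field \<Rightarrow> 'h::banach \<Rightarrow> 'h) \<Rightarrow> 'h set \<Rightarrow> bool" where
  "closed_subspace sc V \<longleftrightarrow> module.subspace sc V \<and> closed V"

definition orth_proj :: "('h::banach \<Rightarrow> 'h \<Rightarrow> 'k::rc_field) \<Rightarrow> 'h set \<Rightarrow> 'h \<Rightarrow> 'h" where
  "orth_proj ip V f = (THE p. p \<in> V \<and> (\<forall>v\<in>V. ip (f - p) v = 0))"

definition weighted_collection ::
    "('k::rc_field \<Rightarrow> 'h::banach \<Rightarrow> 'h) \<Rightarrow> 'i set \<Rightarrow> ('i \<Rightarrow> 'h set) \<Rightarrow> ('i \<Rightarrow> real) \<Rightarrow> bool" where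
  "weighted_collection sc I W w \<longleftrightarrow> countable I \<and> (\<forall>i\<in>I. closed_subspace sc (W i))"

text \<open>
  Since \<open>infsum\<close> is \<open>0\<close> for a divergent family, the finiteness of the sum in the upper bounds
  below is stated explicitly.
\<close>

definition fusion_Bessel ::
    "('k::rc_field \<Rightarrow> 'h::banach \<Rightarrow> 'h) \<Rightarrow> ('h \<Rightarrow> 'h \<Rightarrow> 'k) \<Rightarrow>
     'i set \<Rightarrow> ('i \<Rightarrow> 'h set) \<Rightarrow> ('i \<Rightarrow> real) \<Rightarrow> real \<Rightarrow> bool" where
  "fusion_Bessel sc ip I W w B \<longleftrightarrow>
     weighted_collection sc I W w \<and> B > 0 \<and>
     (\<forall>f. (\<lambda>i. (w i)\<^sup>2 * (norm (orth_proj ip (W i) f))\<^sup>2) summable_on I \<and>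
          (\<Sum>\<^sub>\<infinity>i\<in>I. (w i)\<^sup>2 * (norm (orth_proj ip (W i) f))\<^sup>2) \<le> B * (norm f)\<^sup>2)"

definition K_fusion_frame ::
    "('k::rc_field \<Rightarrow> 'h::banach \<Rightarrow> 'h) \<Rightarrow> ('h \<Rightarrow> 'h \<Rightarrow> 'k) \<Rightarrow> ('h \<Rightarrow> 'h) \<Rightarrow>
     'i set \<Rightarrow> ('i \<Rightarrow> 'h set) \<Rightarrow> ('i \<Rightarrow> real) \<Rightarrow> real \<Rightarrow> real \<Rightarrow> bool" where
  "K_fusion_frame sc ip K I W w A B \<longleftrightarrow>
     weighted_collection sc I W w \<and> A > 0 \<and> B > 0 \<and>
     (\<forall>f. (\<lambda>i. (w i)\<^sup>2 * (norm (orth_proj ip (W i) f))\<^sup>2) summable_on I \<and>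
          A * (norm (adj ip K f))\<^sup>2 \<le> (\<Sum>\<^sub>\<infinity>i\<in>I. (w i)\<^sup>2 * (norm (orth_proj ip (W i) f))\<^sup>2) \<and>
          (\<Sum>\<^sub>\<infinity>i\<in>I. (w i)\<^sup>2 * (norm (orth_proj ip (W i) f))\<^sup>2) \<le> B * (norm f)\<^sup>2)"

text \<open>
  The direct sum is a set of functions, \<open>undefined\<close> off the index set \<open>X\<close> (as for \<open>PiE\<close>), so that
  its elements are determined by their values on \<open>X\<close>.
\<close>

definition l2_sum :: "'i set \<Rightarrow> ('i \<Rightarrow> 'h::banach set) \<Rightarrow> ('i \<Rightarrow> 'h) set" where
  "l2_sum X W = {g \<in> Pi\<^sub>E X W. (\<lambda>i. (norm (g i))\<^sup>2) summable_on X}"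

definition l2_ip ::
    "('h::banach \<Rightarrow> 'h \<Rightarrow> 'k::rc_field) \<Rightarrow> 'i set \<Rightarrow> ('i \<Rightarrow> 'h) \<Rightarrow> ('i \<Rightarrow> 'h) \<Rightarrow> 'k" where
  "l2_ip ip X g h = (\<Sum>\<^sub>\<infinity>i\<in>X. ip (g i) (h i))"

definition l2_norm :: "'i set \<Rightarrow> ('i \<Rightarrow> 'h::banach) \<Rightarrow> real" where
  "l2_norm X g = sqrt (\<Sum>\<^sub>\<infinity>i\<in>X. (norm (g i))\<^sup>2)"

definition synthesis :: "'i set \<Rightarrow> ('i \<Rightarrow> real) \<Rightarrow> ('i \<Rightarrow> 'h::banach) \<Rightarrow> 'h" where
  "synthesis X w g = (\<Sum>\<^sub>\<infinity>i\<in>X. w i *\<^sub>R g i)"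

definition synthesis_norm :: "'i set \<Rightarrow> ('i \<Rightarrow> 'h::banach set) \<Rightarrow> ('i \<Rightarrow> real) \<Rightarrow> real" where
  "synthesis_norm X W w = Sup {norm (synthesis X w g) |g. g \<in> l2_sum X W \<and> l2_norm X g \<le> 1}"

text \<open>
  The adjoint of \<open>synthesis X w\<close> as an operator from \<open>l2_sum X W\<close> to the Hilbert space; for Bessel
  families it maps \<open>f\<close> to the family \<open>w i *\<^sub>R orth_proj ip (W i) f\<close>.
\<close>

definition synthesis_adj ::
    "('h::banach \<Rightarrow> 'h \<Rightarrow> 'k::rc_field) \<Rightarrow> 'i set \<Rightarrow> ('i \<Rightarrow> 'h set) \<Rightarrow> ('i \<Rightarrow> real) \<Rightarrow>
     'h \<Rightarrow> ('i \<Rightarrow> 'h)" where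
  "synthesis_adj ip X W w f =
     (THE g. g \<in> l2_sum X W \<and> (\<forall>h\<in>l2_sum X W. ip (synthesis X w h) f = l2_ip ip X h g))"

end

theory Submission
  imports Defs
begin

text \<open>
  Write \<open>T\<close> for the synthesis operator of the family indexed by \<open>X = I - J\<close>. A subfamily of a
  fusion Bessel sequence is again one, with the same bound, so the upper frame bound is inherited.
  For the lower bound, split off the perturbation term:
  \<open>\<parallel>K\<^sup>* f\<parallel> \<le> \<parallel>(K\<^sup>* - T T\<^sup>*) f\<parallel> + \<parallel>T T\<^sup>* f\<parallel> \<le> a \<parallel>K\<^sup>* f\<parallel> + (b + \<parallel>T\<parallel>) \<parallel>T\<^sup>* f\<parallel>\<close>,
  that is \<open>(1 - a) \<parallel>K\<^sup>* f\<parallel> \<le> (b + \<parallel>T\<parallel>) \<parallel>T\<^sup>* f\<parallel>\<close>. Squaring finishes the proof, because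
  \<open>T\<^sup>* f = (w\<^sub>i P\<^sub>i f)\<^sub>i\<close> and therefore \<open>\<parallel>T\<^sup>* f\<parallel>\<^sup>2 = \<Sum> w\<^sub>i\<^sup>2 \<parallel>P\<^sub>i f\<parallel>\<^sup>2\<close>.

  Most of the work lies in showing that these objects, which are introduced by definite
  descriptions, infinite sums and suprema, are what their notation promises. Orthogonal projections
  onto closed subspaces exist by the classical minimal distance argument (\<open>orth_proj_props\<close>). The
  series defining \<open>T g\<close> need not converge absolutely; it converges unconditionally because its
  finite partial sums satisfy \<open>\<parallel>\<Sum>\<^sub>F w\<^sub>i g\<^sub>i\<parallel>\<^sup>2 \<le> B \<Sum>\<^sub>F \<parallel>g\<^sub>i\<parallel>\<^sup>2\<close>, by duality with the Bessel
  inequality (\<open>synthesis_finite_bound\<close>). The same estimate makes \<open>\<parallel>T\<parallel>\<close> a finite supremum, so that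
  \<open>\<parallel>T g\<parallel> \<le> \<parallel>T\<parallel> \<parallel>g\<parallel>\<close> (\<open>synthesis_norm_bound\<close>), and termwise application of the inner product
  identifies \<open>T\<^sup>*\<close> (\<open>synthesis_adj_eq\<close>).
\<close>

section \<open>Conjugation and inner products\<close>

lemma cj_0 [simp]: "cj 0 = (0 :: 'k::rc_field)"
  using cj_add[of 0 "0::'k"] by simp

lemma norm_cj [simp]: "norm (cj (x :: 'k::rc_field)) = norm x"
proof (cases "x = 0")
  case False
  have "norm x * norm (cj x) = (norm x)\<^sup>2"
    by (simp add: norm_mult [symmetric] mult_cj)
  with False show ?thesis by (simp add: power2_eq_square)
qed simp

lemma cj_of_real [simp]: "cj (of_real r) = (of_real r :: 'k::rc_field)"
proof (cases "r = 0")
  case False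
  have "of_real r * cj (of_real r :: 'k) = of_real r * of_real r"
    by (simp add: mult_cj scaleR_conv_of_real power2_eq_square)
  with False show ?thesis by simp
qed simp

text \<open>
  Multiplicativity is not an axiom of the class. It holds because, away from \<open>0\<close>, the axiom
  \<open>mult_cj\<close> forces \<open>cj x = \<parallel>x\<parallel>\<^sup>2 / x\<close>, and the norm of a normed field is multiplicative.
\<close>

lemma cj_mult: "cj (x * y) = cj x * cj (y :: 'k::rc_field)"
proof (cases "x = 0 \<or> y = 0")
  case False
  have "(x * y) * cj (x * y) = (x * y) * (cj x * cj y)"
  proof -
    have "(x * y) * (cj x * cj y) = (x * cj x) * (y * cj y)"
      by (simp add: algebra_simps)
    then show ?thesis
      by (simp add: mult_cj norm_mult power_mult_distrib)
  qed
  with False show ?thesis by simp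
qed auto

context hilbert_space
begin

lemma ip_add_right: "ip x (y + z) = ip x y + ip x z"
  by (metis ip_commute ip_add_left cj_add)

lemma ip_sc_right: "ip x (sc c y) = cj c * ip x y"
  by (metis ip_commute ip_sc_left cj_mult)

lemma ip_scaleR_left: "ip (r *\<^sub>R x) y = of_real r * ip x y"
  by (metis sc_of_real ip_sc_left)

lemma ip_scaleR_right: "ip x (r *\<^sub>R y) = of_real r * ip x y"
  by (metis sc_of_real ip_sc_right cj_of_real)

lemma ip_zero_left [simp]: "ip 0 y = 0"
  using ip_scaleR_left[of 0 0 y] by simp

lemma ip_zero_right [simp]: "ip y 0 = 0"
  using ip_scaleR_right[of y 0 0] by simp

lemma ip_diff_left: "ip (x - y) z = ip x z - ip y z"
  using ip_add_left[of "x - y" y z] by simp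

lemma ip_diff_right: "ip x (y - z) = ip x y - ip x z"
  using ip_add_right[of x "y - z" z] by simp

lemma ip_sum_left: "ip (\<Sum>i\<in>F. g i) y = (\<Sum>i\<in>F. ip (g i) y)"
  by (induction F rule: infinite_finite_induct) (simp_all add: ip_add_left)

lemma norm_ip_self: "norm (ip x x) = (norm x)\<^sup>2"
  by (simp add: ip_self norm_power)

lemma ip_self_eq_0: "ip x x = 0 \<Longrightarrow> x = 0"
  using norm_ip_self[of x] by simp

lemma ip_eq_0_commute: "ip x y = 0 \<Longrightarrow> ip y x = 0"
  using ip_commute[of y x] by simp

lemma pythagoras:
  assumes "ip x y = 0"
  shows "(norm (x + y))\<^sup>2 = (norm x)\<^sup>2 + (norm y)\<^sup>2"
proof -
  have "ip (x + y) (x + y) = ip x x + ip y y"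
    using assms ip_eq_0_commute[OF assms] by (simp add: ip_add_left ip_add_right)
  then have "(of_real ((norm (x + y))\<^sup>2) :: 'k) = of_real ((norm x)\<^sup>2 + (norm y)\<^sup>2)"
    by (simp only: ip_self of_real_add)
  then show ?thesis by (simp only: of_real_eq_iff)
qed

lemma parallelogram: "(norm (x + y))\<^sup>2 + (norm (x - y))\<^sup>2 = 2 * (norm x)\<^sup>2 + 2 * (norm y)\<^sup>2"
  for x y :: 'h
proof -
  have "ip (x + y) (x + y) + ip (x - y) (x - y) = (ip x x + ip x x) + (ip y y + ip y y)"
    by (simp add: ip_add_left ip_add_right ip_diff_left ip_diff_right)
  then have "(of_real ((norm (x + y))\<^sup>2 + (norm (x - y))\<^sup>2) :: 'k)
      = of_real (((norm x)\<^sup>2 + (norm x)\<^sup>2) + ((norm y)\<^sup>2 + (norm y)\<^sup>2))"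
    by (simp only: ip_self of_real_add)
  then show ?thesis by (simp only: of_real_eq_iff)
qed

lemma norm_sc: "norm (sc c x) = norm c * norm x"
proof -
  have "ip (sc c x) (sc c x) = (c * cj c) * ip x x"
    by (simp add: ip_sc_left ip_sc_right)
  then have "norm (ip (sc c x) (sc c x)) = (norm c)\<^sup>2 * (norm x)\<^sup>2"
    by (simp add: norm_mult norm_ip_self power2_eq_square)
  then have "(norm (sc c x))\<^sup>2 = (norm c * norm x)\<^sup>2"
    by (simp add: norm_ip_self power_mult_distrib)
  then show ?thesis by (simp add: power2_eq_iff_nonneg)
qed

text \<open>
  Subtracting from \<open>x\<close> its component along \<open>y\<close> shortens it by an explicit amount. That the result
  has nonnegative norm is the Cauchy--Schwarz inequality; that a shortest vector cannot be shortened
  gives the orthogonality of minimal distance vectors in \<open>orth_proj_exists\<close>.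
\<close>

lemma norm_minus_component:
  assumes "y \<noteq> 0"
  shows "(norm (x - sc (ip x y / of_real ((norm y)\<^sup>2)) y))\<^sup>2
           = (norm x)\<^sup>2 - (norm (ip x y))\<^sup>2 / (norm y)\<^sup>2"
proof -
  define c where "c = ip x y / of_real ((norm y)\<^sup>2)"
  have "ip (x - sc c y) y = 0"
    using assms by (simp add: ip_diff_left ip_sc_left ip_self c_def)
  then have "ip (x - sc c y) (sc c y) = 0"
    by (simp add: ip_sc_right)
  from pythagoras[OF this] have "(norm x)\<^sup>2 = (norm (x - sc c y))\<^sup>2 + (norm (sc c y))\<^sup>2"
    by simp
  moreover have "(norm (sc c y))\<^sup>2 = (norm (ip x y))\<^sup>2 / (norm y)\<^sup>2"
    using assms by (simp add: norm_sc c_def norm_divide norm_power power_divide power_mult_distrib)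
      (simp add: power2_eq_square power4_eq_xxxx)
  ultimately show ?thesis by (simp add: c_def)
qed

lemma Cauchy_Schwarz: "norm (ip x y) \<le> norm x * norm y"
proof (cases "y = 0")
  case False
  have "0 \<le> (norm x)\<^sup>2 - (norm (ip x y))\<^sup>2 / (norm y)\<^sup>2"
    using norm_minus_component[OF False, of x] by (metis zero_le_power2)
  then have "(norm (ip x y))\<^sup>2 \<le> (norm x * norm y)\<^sup>2"
    using False by (simp add: field_simps power_mult_distrib)
  then show ?thesis by (rule power2_le_imp_le) simp
qed simp

lemma bounded_linear_ip_left: "bounded_linear (\<lambda>x. ip x y)"
  by (rule bounded_linear_intro[where K = "norm y"])
    (simp_all add: ip_add_left ip_scaleR_left scaleR_conv_of_real Cauchy_Schwarz)

section \<open>Orthogonal projections onto closed subspaces\<close>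

lemma closed_subspaceD:
  assumes "closed_subspace sc V"
  shows "0 \<in> V" "u \<in> V \<Longrightarrow> v \<in> V \<Longrightarrow> u + v \<in> V" "u \<in> V \<Longrightarrow> sc c u \<in> V"
    "u \<in> V \<Longrightarrow> r *\<^sub>R u \<in> V" "u \<in> V \<Longrightarrow> v \<in> V \<Longrightarrow> u - v \<in> V" "closed V"
proof -
  have V: "subspace V" and "closed V"
    using assms by (auto simp: closed_subspace_def)
  show "0 \<in> V" "u \<in> V \<Longrightarrow> v \<in> V \<Longrightarrow> u + v \<in> V" "u \<in> V \<Longrightarrow> sc c u \<in> V"
    "u \<in> V \<Longrightarrow> v \<in> V \<Longrightarrow> u - v \<in> V" "closed V"
    using V \<open>closed V\<close> by (auto intro: subspace_0 subspace_add subspace_scale subspace_diff)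
  show "u \<in> V \<Longrightarrow> r *\<^sub>R u \<in> V"
    using subspace_scale[OF V, of u "of_real r"] by (simp add: sc_of_real)
qed

text \<open>
  A sequence in \<open>V\<close> whose distances to \<open>f\<close> approach the infimum is Cauchy: the midpoint of two of
  its members is in \<open>V\<close> as well, hence not much closer to \<open>f\<close>, and the parallelogram law then
  bounds their distance.
\<close>

lemma nearest_point_exists:
  assumes V: "closed_subspace sc V"
  shows "\<exists>p\<in>V. \<forall>v\<in>V. norm (f - p) \<le> norm (f - v)"
proof -
  define d where "d = Inf ((\<lambda>v. (norm (f - v))\<^sup>2) ` V)"
  have ne: "(\<lambda>v. (norm (f - v))\<^sup>2) ` V \<noteq> {}"
    using closed_subspaceD(1)[OF V] by auto
  have d_le: "d \<le> (norm (f - v))\<^sup>2" if "v \<in> V" for v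
    unfolding d_def using that by (intro cInf_lower) (auto intro: bdd_belowI[of _ 0])
  have "\<exists>v\<in>V. (norm (f - v))\<^sup>2 < d + e" if "e > 0" for e
    using cInf_lessD[OF ne, of "d + e"] that by (auto simp: d_def)
  then have "\<forall>n. \<exists>v\<in>V. (norm (f - v))\<^sup>2 < d + inverse (real (Suc n))"
    by simp
  then obtain v where vV: "\<And>n. v n \<in> V"
    and v: "\<And>n. (norm (f - v n))\<^sup>2 < d + inverse (real (Suc n))"
    by metis
  have diff: "(norm (v m - v n))\<^sup>2 \<le> 2 * inverse (real (Suc m)) + 2 * inverse (real (Suc n))"
    for m n
  proof -
    have "(1 / 2) *\<^sub>R (v m + v n) \<in> V"
      by (intro closed_subspaceD(4)[OF V] closed_subspaceD(2)[OF V] vV)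
    from d_le[OF this] have "4 * d \<le> 4 * (norm (f - (1 / 2) *\<^sub>R (v m + v n)))\<^sup>2"
      by simp
    also have "\<dots> = (norm (2 *\<^sub>R (f - (1 / 2) *\<^sub>R (v m + v n))))\<^sup>2"
      by (simp add: power_mult_distrib)
    also have "2 *\<^sub>R (f - (1 / 2) *\<^sub>R (v m + v n)) = (f - v m) + (f - v n)"
      by (simp add: algebra_simps scaleR_2)
    finally have "4 * d \<le> (norm ((f - v m) + (f - v n)))\<^sup>2" .
    moreover have "norm ((f - v m) - (f - v n)) = norm (v m - v n)"
      by (simp add: norm_minus_commute)
    ultimately show ?thesis
      using parallelogram[of "f - v m" "f - v n"] v[of m] v[of n] by simp
  qed
  have "Cauchy v"
  proof (rule CauchyI)
    fix e :: real assume "e > 0"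
    then obtain N where N: "inverse (real (Suc N)) < e\<^sup>2 / 4"
      using reals_Archimedean[of "e\<^sup>2 / 4"] by auto
    have "norm (v m - v n) < e" if "m \<ge> N" "n \<ge> N" for m n
    proof -
      have "inverse (real (Suc m)) \<le> inverse (real (Suc N))"
        "inverse (real (Suc n)) \<le> inverse (real (Suc N))"
        using that by (auto intro!: le_imp_inverse_le)
      then have "(norm (v m - v n))\<^sup>2 < e\<^sup>2"
        using diff[of m n] N by linarith
      then show ?thesis
        by (rule power2_less_imp_less) (use \<open>e > 0\<close> in simp)
    qed
    then show "\<exists>M. \<forall>m\<ge>M. \<forall>n\<ge>M. norm (v m - v n) < e" by blast
  qed
  then obtain p where p: "v \<longlonglongrightarrow> p"
    using Cauchy_convergent_iff convergent_def by blast
  have "p \<in> V"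
    using closed_subspaceD(6)[OF V] vV p by (meson closed_sequentially)
  moreover have "(norm (f - p))\<^sup>2 \<le> d"
  proof (rule LIMSEQ_le)
    show "(\<lambda>n. (norm (f - v n))\<^sup>2) \<longlonglongrightarrow> (norm (f - p))\<^sup>2"
      by (intro tendsto_intros p)
    show "(\<lambda>n. d + inverse (real (Suc n))) \<longlonglongrightarrow> d"
      using tendsto_add[OF tendsto_const LIMSEQ_inverse_real_of_nat, of d] by simp
    show "\<exists>N. \<forall>n\<ge>N. (norm (f - v n))\<^sup>2 \<le> d + inverse (real (Suc n))"
      using v less_imp_le by blast
  qed
  moreover have "norm (f - p) \<le> norm (f - u)" if "(norm (f - p))\<^sup>2 \<le> d" "u \<in> V" for u
    using order_trans[OF that(1) d_le[OF that(2)]] by (rule power2_le_imp_le) simp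
  ultimately show ?thesis by blast
qed

lemma orth_proj_exists:
  assumes V: "closed_subspace sc V"
  shows "\<exists>p\<in>V. \<forall>v\<in>V. ip (f - p) v = 0"
proof -
  obtain p where p: "p \<in> V" "\<And>v. v \<in> V \<Longrightarrow> norm (f - p) \<le> norm (f - v)"
    using nearest_point_exists[OF V] by blast
  have "ip (f - p) v = 0" if "v \<in> V" for v
  proof (cases "v = 0")
    case False
    define c where "c = ip (f - p) v / of_real ((norm v)\<^sup>2)"
    have "p + sc c v \<in> V"
      by (intro closed_subspaceD(2,3)[OF V] p(1) that)
    from p(2)[OF this] have "(norm (f - p))\<^sup>2 \<le> (norm (f - p - sc c v))\<^sup>2"
      by (simp add: diff_diff_eq power_mono)
    then have "(norm (ip (f - p) v))\<^sup>2 / (norm v)\<^sup>2 \<le> 0"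
      using norm_minus_component[OF False, of "f - p"] by (simp only: c_def)
    then show ?thesis
      using False by (simp add: divide_le_0_iff)
  qed simp
  with p(1) show ?thesis by blast
qed

lemma orth_proj_props:
  assumes V: "closed_subspace sc V"
  shows "orth_proj ip V f \<in> V" "v \<in> V \<Longrightarrow> ip (f - orth_proj ip V f) v = 0"
proof -
  have "\<exists>!p. p \<in> V \<and> (\<forall>v\<in>V. ip (f - p) v = 0)"
  proof (rule ex_ex1I)
    show "\<exists>p. p \<in> V \<and> (\<forall>v\<in>V. ip (f - p) v = 0)"
      using orth_proj_exists[OF V] by blast
  next
    fix p q
    assume p: "p \<in> V \<and> (\<forall>v\<in>V. ip (f - p) v = 0)" and q: "q \<in> V \<and> (\<forall>v\<in>V. ip (f - q) v = 0)"
    then have "p - q \<in> V"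
      using closed_subspaceD(5)[OF V] by blast
    then have "ip (f - q) (p - q) - ip (f - p) (p - q) = 0"
      using p q by simp
    then have "ip (p - q) (p - q) = 0"
      by (simp add: ip_diff_left)
    then show "p = q"
      using ip_self_eq_0[of "p - q"] by simp
  qed
  from theI'[OF this]
  show "orth_proj ip V f \<in> V" "v \<in> V \<Longrightarrow> ip (f - orth_proj ip V f) v = 0"
    unfolding orth_proj_def by auto
qed

lemma ip_orth_proj:
  assumes "closed_subspace sc V" "v \<in> V"
  shows "ip v (orth_proj ip V f) = ip v f"
proof -
  have "ip v (f - orth_proj ip V f) = 0"
    using orth_proj_props(2)[OF assms] by (rule ip_eq_0_commute)
  then show ?thesis by (simp add: ip_diff_right)
qed

end

section \<open>Unconditional convergence from square-summable majorants\<close>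

text \<open>
  A criterion for families that may fail to be absolutely summable: it is enough that every finite
  partial sum, taken over any part of the index set, is controlled by the corresponding part of a
  convergent nonnegative series, since the tails of that series are small.
\<close>

lemma summable_on_of_finite_square_bound:
  fixes v :: "'i \<Rightarrow> 'h::banach" and q :: "'i \<Rightarrow> real"
  assumes c: "c \<ge> 0" and q: "q summable_on X" "\<And>i. i \<in> X \<Longrightarrow> q i \<ge> 0"
    and bound: "\<And>F. finite F \<Longrightarrow> F \<subseteq> X \<Longrightarrow> (norm (sum v F))\<^sup>2 \<le> c * sum q F"
  shows "v summable_on X" and "(norm (infsum v X))\<^sup>2 \<le> c * infsum q X"
proof -
  have small: "\<exists>P. eventually P (finite_subsets_at_top X) \<and>
      (\<forall>F F'. P F \<and> P F' \<longrightarrow> dist (sum v F) (sum v F') < e)" if "e > 0" for e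
  proof -
    define d where "d = (e / 2)\<^sup>2 / (c + 1)"
    have "d > 0" using c \<open>e > 0\<close> by (simp add: d_def)
    have cd: "c * d < (e / 2)\<^sup>2"
      using c \<open>e > 0\<close> by (simp add: d_def field_simps)
    obtain F0 where F0: "finite F0" "F0 \<subseteq> X" "dist (sum q F0) (infsum q X) \<le> d"
      using infsum_finite_approximation[OF q(1) \<open>d > 0\<close>] by blast
    define P where "P F \<longleftrightarrow> finite F \<and> F0 \<subseteq> F \<and> F \<subseteq> X" for F
    have ev: "eventually P (finite_subsets_at_top X)"
      unfolding P_def eventually_finite_subsets_at_top using F0 by blast
    have near: "dist (sum v F) (sum v F0) < e / 2" if "P F" for F
    proof -
      have F: "finite F" "F0 \<subseteq> F" "F \<subseteq> X" using that by (auto simp: P_def)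
      have "sum q F \<le> infsum q X"
        using F q by (intro finite_sum_le_infsum) auto
      then have tail: "sum q (F - F0) \<le> d"
        using F0(3) F by (simp add: sum_diff dist_real_def)
      have "(norm (sum v (F - F0)))\<^sup>2 \<le> c * sum q (F - F0)"
        using F by (intro bound) auto
      also have "\<dots> \<le> c * d"
        using tail c by (rule mult_left_mono)
      finally have "(norm (sum v (F - F0)))\<^sup>2 < (e / 2)\<^sup>2"
        using cd by simp
      then have "norm (sum v (F - F0)) < e / 2"
        by (rule power2_less_imp_less) (use \<open>e > 0\<close> in simp)
      then show ?thesis
        using F by (simp add: sum_diff dist_norm)
    qed
    have "dist (sum v F) (sum v F') < e" if "P F" "P F'" for F F'
      using near[OF that(1)] near[OF that(2)] by (rule dist_triangle_half_l)
    with ev show ?thesis by blast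
  qed
  have "cauchy_filter (filtermap (sum v) (finite_subsets_at_top X))"
    unfolding cauchy_filter_metric_filtermap using small by blast
  moreover have "complete (UNIV :: 'h set)"
    by (meson Cauchy_convergent UNIV_I complete_def convergent_def)
  ultimately obtain L where "(sum v \<longlongrightarrow> L) (finite_subsets_at_top X)"
    using complete_uniform[where S = UNIV] by (force simp add: filterlim_def)
  then show v: "v summable_on X"
    using summable_on_def has_sum_def by blast
  show "(norm (infsum v X))\<^sup>2 \<le> c * infsum q X"
  proof (rule tendsto_le[OF finite_subsets_at_top_neq_bot])
    show "((\<lambda>F. c * sum q F) \<longlongrightarrow> c * infsum q X) (finite_subsets_at_top X)"
      by (intro tendsto_intros infsum_tendsto q(1))
    show "((\<lambda>F. (norm (sum v F))\<^sup>2) \<longlongrightarrow> (norm (infsum v X))\<^sup>2) (finite_subsets_at_top X)"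
      by (intro tendsto_intros infsum_tendsto v)
    show "\<forall>\<^sub>F F in finite_subsets_at_top X. (norm (sum v F))\<^sup>2 \<le> c * sum q F"
      using bound by (intro eventually_finite_subsets_at_top_weakI) auto
  qed
qed

section \<open>The synthesis operator of a fusion Bessel sequence\<close>

lemma l2_norm_nonneg: "l2_norm X g \<ge> 0"
  by (simp add: l2_norm_def infsum_nonneg)

lemma l2_norm_square: "(l2_norm X g)\<^sup>2 = (\<Sum>\<^sub>\<infinity>i\<in>X. (norm (g i))\<^sup>2)"
  by (simp add: l2_norm_def infsum_nonneg)

lemma synthesis_scaleR:
  "synthesis X w (\<lambda>i\<in>X. r *\<^sub>R g i) = r *\<^sub>R synthesis X w g"
proof -
  have "synthesis X w (\<lambda>i\<in>X. r *\<^sub>R g i) = (\<Sum>\<^sub>\<infinity>i\<in>X. r *\<^sub>R (w i *\<^sub>R g i))"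
    unfolding synthesis_def by (rule infsum_cong) (simp add: mult.commute)
  then show ?thesis
    by (simp only: infsum_scaleR_right synthesis_def)
qed

lemma l2_norm_scaleR: "l2_norm X (\<lambda>i\<in>X. r *\<^sub>R g i) = \<bar>r\<bar> * l2_norm X g"
proof -
  have "(\<Sum>\<^sub>\<infinity>i\<in>X. (norm ((\<lambda>i\<in>X. r *\<^sub>R g i) i))\<^sup>2) = (\<Sum>\<^sub>\<infinity>i\<in>X. r\<^sup>2 * (norm (g i))\<^sup>2)"
    by (rule infsum_cong) (simp add: power_mult_distrib)
  then show ?thesis
    by (simp add: l2_norm_def infsum_cmult_right' real_sqrt_mult)
qed

context hilbert_space
begin

lemma fusion_Bessel_subset:
  assumes "fusion_Bessel sc ip I W w B" "X \<subseteq> I"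
  shows "fusion_Bessel sc ip X W w B"
proof -
  have "(\<lambda>i. (w i)\<^sup>2 * (norm (orth_proj ip (W i) f))\<^sup>2) summable_on X \<and>
      (\<Sum>\<^sub>\<infinity>i\<in>X. (w i)\<^sup>2 * (norm (orth_proj ip (W i) f))\<^sup>2) \<le> B * (norm f)\<^sup>2" for f
  proof -
    have I: "(\<lambda>i. (w i)\<^sup>2 * (norm (orth_proj ip (W i) f))\<^sup>2) summable_on I"
      "(\<Sum>\<^sub>\<infinity>i\<in>I. (w i)\<^sup>2 * (norm (orth_proj ip (W i) f))\<^sup>2) \<le> B * (norm f)\<^sup>2"
      using assms(1) by (auto simp: fusion_Bessel_def)
    have X: "(\<lambda>i. (w i)\<^sup>2 * (norm (orth_proj ip (W i) f))\<^sup>2) summable_on X"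
      using I(1) assms(2) by (rule summable_on_subset_banach)
    from infsum_mono2[OF X I(1) assms(2)] show ?thesis
      using X I(2) by simp
  qed
  moreover have "weighted_collection sc X W w" and "B > 0"
    using assms by (auto simp: fusion_Bessel_def weighted_collection_def intro: countable_subset)
  ultimately show ?thesis
    by (simp add: fusion_Bessel_def)
qed

lemma l2_sum_scaleR:
  assumes "weighted_collection sc X W w" "g \<in> l2_sum X W"
  shows "(\<lambda>i\<in>X. r *\<^sub>R g i) \<in> l2_sum X W"
proof -
  have "(\<lambda>i. (norm ((\<lambda>i\<in>X. r *\<^sub>R g i) i))\<^sup>2) summable_on X
      \<longleftrightarrow> (\<lambda>i. r\<^sup>2 * (norm (g i))\<^sup>2) summable_on X"
    by (rule summable_on_cong) (simp add: power_mult_distrib)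
  moreover have "(\<lambda>i. r\<^sup>2 * (norm (g i))\<^sup>2) summable_on X"
    using assms(2) by (auto simp: l2_sum_def intro: summable_on_cmult_right)
  ultimately show ?thesis
    using assms by (auto simp: l2_sum_def weighted_collection_def PiE_def Pi_def
        intro: closed_subspaceD(4))
qed

text \<open>
  With \<open>s = \<Sum>\<^sub>F w\<^sub>i g\<^sub>i\<close>, the number \<open>\<parallel>s\<parallel>\<^sup>2 = \<Sum>\<^sub>F \<langle>g\<^sub>i, w\<^sub>i P\<^sub>i s\<rangle>\<close> is at most the product of the
  square roots of \<open>\<Sum>\<^sub>F \<parallel>g\<^sub>i\<parallel>\<^sup>2\<close> and of \<open>\<Sum>\<^sub>F w\<^sub>i\<^sup>2 \<parallel>P\<^sub>i s\<parallel>\<^sup>2 \<le> B \<parallel>s\<parallel>\<^sup>2\<close>; now cancel \<open>\<parallel>s\<parallel>\<close>.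
\<close>

lemma synthesis_finite_bound:
  assumes bes: "fusion_Bessel sc ip X W w B"
    and g: "\<And>i. i \<in> X \<Longrightarrow> g i \<in> W i" and F: "finite F" "F \<subseteq> X"
  shows "(norm (\<Sum>i\<in>F. w i *\<^sub>R g i))\<^sup>2 \<le> B * (\<Sum>i\<in>F. (norm (g i))\<^sup>2)"
proof -
  define s where "s = (\<Sum>i\<in>F. w i *\<^sub>R g i)"
  define P where "P i = orth_proj ip (W i) s" for i
  define G where "G = L2_set (\<lambda>i. norm (g i)) F"
  define H where "H = L2_set (\<lambda>i. norm (w i *\<^sub>R P i)) F"
  have B: "B > 0" and cl: "\<And>i. i \<in> X \<Longrightarrow> closed_subspace sc (W i)"
    using bes by (auto simp: fusion_Bessel_def weighted_collection_def)
  have "ip s s = (\<Sum>i\<in>F. ip (w i *\<^sub>R g i) s)"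
    by (subst s_def) (simp add: ip_sum_left)
  also have "\<dots> = (\<Sum>i\<in>F. ip (g i) (w i *\<^sub>R P i))"
  proof (rule sum.cong)
    fix i assume "i \<in> F"
    then have "i \<in> X" using F by blast
    then show "ip (w i *\<^sub>R g i) s = ip (g i) (w i *\<^sub>R P i)"
      using ip_orth_proj[OF cl g, of i s]
      by (simp add: P_def ip_scaleR_left ip_scaleR_right)
  qed simp
  finally have "(norm s)\<^sup>2 = norm (\<Sum>i\<in>F. ip (g i) (w i *\<^sub>R P i))"
    by (simp add: norm_ip_self[symmetric])
  also have "\<dots> \<le> (\<Sum>i\<in>F. \<bar>norm (g i)\<bar> * \<bar>norm (w i *\<^sub>R P i)\<bar>)"
    by (rule sum_norm_le) (metis Cauchy_Schwarz abs_norm_cancel)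
  also have "\<dots> \<le> G * H"
    unfolding G_def H_def by (rule L2_set_mult_ineq)
  finally have 1: "(norm s)\<^sup>2 \<le> G * H" .
  have "H\<^sup>2 = (\<Sum>i\<in>F. (w i)\<^sup>2 * (norm (P i))\<^sup>2)"
    by (simp add: H_def L2_set_def sum_nonneg power_mult_distrib)
  also have "\<dots> \<le> (\<Sum>\<^sub>\<infinity>i\<in>X. (w i)\<^sup>2 * (norm (P i))\<^sup>2)"
    using bes F unfolding P_def fusion_Bessel_def by (intro finite_sum_le_infsum) auto
  also have "\<dots> \<le> B * (norm s)\<^sup>2"
    using bes by (simp add: P_def fusion_Bessel_def)
  finally have 2: "H\<^sup>2 \<le> B * (norm s)\<^sup>2" .
  have G2: "G\<^sup>2 = (\<Sum>i\<in>F. (norm (g i))\<^sup>2)"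
    by (simp add: G_def L2_set_def sum_nonneg)
  have "(norm s)\<^sup>2 \<le> B * G\<^sup>2"
  proof (cases "s = 0")
    case True
    then show ?thesis using B by simp
  next
    case False
    have "(norm s)\<^sup>2 * (norm s)\<^sup>2 \<le> (G * H) * (G * H)"
      using 1 by (intro mult_mono) (auto simp: G_def H_def)
    also have "\<dots> = G\<^sup>2 * H\<^sup>2"
      by (simp add: power2_eq_square)
    also have "\<dots> \<le> G\<^sup>2 * (B * (norm s)\<^sup>2)"
      using 2 by (rule mult_left_mono) simp
    finally have "(norm s)\<^sup>2 * (norm s)\<^sup>2 \<le> (B * G\<^sup>2) * (norm s)\<^sup>2"
      by (simp add: algebra_simps)
    then show ?thesis
      by (rule mult_right_le_imp_le) (simp add: False)
  qed
  then show ?thesis by (simp add: s_def G2)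
qed

lemma synthesis_converges:
  assumes bes: "fusion_Bessel sc ip X W w B" and g: "g \<in> l2_sum X W"
  shows "(\<lambda>i. w i *\<^sub>R g i) summable_on X"
    and "norm (synthesis X w g) \<le> sqrt B * l2_norm X g"
proof -
  have B: "B \<ge> 0" using bes by (simp add: fusion_Bessel_def)
  have gW: "\<And>i. i \<in> X \<Longrightarrow> g i \<in> W i" and sq: "(\<lambda>i. (norm (g i))\<^sup>2) summable_on X"
    using g by (auto simp: l2_sum_def)
  note sum = summable_on_of_finite_square_bound[OF B sq _ synthesis_finite_bound[OF bes gW]]
  show "(\<lambda>i. w i *\<^sub>R g i) summable_on X"
    by (rule sum(1)) auto
  have "(norm (synthesis X w g))\<^sup>2 \<le> B * (l2_norm X g)\<^sup>2"
    unfolding l2_norm_square synthesis_def by (rule sum(2)) auto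
  also have "\<dots> = (sqrt B * l2_norm X g)\<^sup>2"
    using B by (simp add: power_mult_distrib)
  finally show "norm (synthesis X w g) \<le> sqrt B * l2_norm X g"
    by (rule power2_le_imp_le) (simp add: B l2_norm_nonneg)
qed

lemma synthesis_norm_upper:
  assumes bes: "fusion_Bessel sc ip X W w B" and "g \<in> l2_sum X W" "l2_norm X g \<le> 1"
  shows "norm (synthesis X w g) \<le> synthesis_norm X W w"
  unfolding synthesis_norm_def
proof (rule cSup_upper)
  show "bdd_above {norm (synthesis X w g) |g. g \<in> l2_sum X W \<and> l2_norm X g \<le> 1}"
  proof (rule bdd_aboveI)
    fix x assume "x \<in> {norm (synthesis X w g) |g. g \<in> l2_sum X W \<and> l2_norm X g \<le> 1}"
    then obtain h where h: "x = norm (synthesis X w h)" "h \<in> l2_sum X W" "l2_norm X h \<le> 1"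
      by blast
    have "x \<le> sqrt B * l2_norm X h"
      using synthesis_converges(2)[OF bes h(2)] h(1) by simp
    also have "\<dots> \<le> sqrt B * 1"
      using h(3) bes by (intro mult_left_mono) (auto simp: fusion_Bessel_def)
    finally show "x \<le> sqrt B" by simp
  qed
  show "norm (synthesis X w g) \<in> {norm (synthesis X w g) |g. g \<in> l2_sum X W \<and> l2_norm X g \<le> 1}"
    using assms(2,3) by blast
qed

lemma synthesis_norm_nonneg:
  assumes bes: "fusion_Bessel sc ip X W w B"
  shows "synthesis_norm X W w \<ge> 0"
proof -
  define z where "z = (\<lambda>i\<in>X. 0 :: 'h)"
  have sum: "((\<lambda>i. (norm (z i))\<^sup>2) has_sum 0) X"
    by (rule has_sum_0) (simp add: z_def)
  have "\<And>i. i \<in> X \<Longrightarrow> 0 \<in> W i"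
    using bes closed_subspaceD(1) unfolding fusion_Bessel_def weighted_collection_def by blast
  then have "z \<in> l2_sum X W"
    using has_sum_imp_summable[OF sum] by (simp add: l2_sum_def z_def)
  moreover have "l2_norm X z \<le> 1"
    by (simp add: l2_norm_def infsumI[OF sum])
  ultimately have "norm (synthesis X w z) \<le> synthesis_norm X W w"
    by (rule synthesis_norm_upper[OF bes])
  then show ?thesis
    by (rule order_trans[OF norm_ge_zero])
qed

lemma synthesis_norm_bound:
  assumes bes: "fusion_Bessel sc ip X W w B" and g: "g \<in> l2_sum X W"
  shows "norm (synthesis X w g) \<le> synthesis_norm X W w * l2_norm X g"
proof (cases "l2_norm X g = 0")
  case True
  then show ?thesis
    using synthesis_converges(2)[OF bes g] by simp
next
  case False
  then have pos: "l2_norm X g > 0"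
    using l2_norm_nonneg[of X g] by simp
  define h where "h = (\<lambda>i\<in>X. inverse (l2_norm X g) *\<^sub>R g i)"
  have "h \<in> l2_sum X W"
    using bes g unfolding h_def fusion_Bessel_def by (blast intro: l2_sum_scaleR)
  moreover have "l2_norm X h \<le> 1"
    using pos by (simp add: h_def l2_norm_scaleR)
  ultimately have "norm (synthesis X w h) \<le> synthesis_norm X W w"
    by (rule synthesis_norm_upper[OF bes])
  then show ?thesis
    using pos by (simp add: h_def synthesis_scaleR field_simps)
qed

text \<open>
  The adjoint identity is the continuity of the inner product, applied termwise. That it determines
  the value of the adjoint is tested on the families supported at a single index.
\<close>

lemma synthesis_adj_eq:
  assumes bes: "fusion_Bessel sc ip X W w B"
  shows "synthesis_adj ip X W w f = (\<lambda>i\<in>X. w i *\<^sub>R orth_proj ip (W i) f)" (is "_ = ?g")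
    and "(\<lambda>i\<in>X. w i *\<^sub>R orth_proj ip (W i) f) \<in> l2_sum X W"
proof -
  have cl: "\<And>i. i \<in> X \<Longrightarrow> closed_subspace sc (W i)"
    and sq: "(\<lambda>i. (w i)\<^sup>2 * (norm (orth_proj ip (W i) f))\<^sup>2) summable_on X"
    using bes by (auto simp: fusion_Bessel_def weighted_collection_def)
  have "(\<lambda>i. (norm (?g i))\<^sup>2) summable_on X"
    using sq by (rule summable_on_cong[THEN iffD1, rotated]) (simp add: power_mult_distrib)
  then show g: "?g \<in> l2_sum X W"
    using cl by (auto simp: l2_sum_def intro!: closed_subspaceD(4) orth_proj_props(1))
  have pointwise: "ip (w i *\<^sub>R v) f = ip v (?g i)" if "i \<in> X" "v \<in> W i" for i v
    using that ip_orth_proj[OF cl that(2), of f] by (simp add: ip_scaleR_left ip_scaleR_right)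
  have adjoint: "ip (synthesis X w h) f = l2_ip ip X h ?g" if "h \<in> l2_sum X W" for h
  proof -
    have "((\<lambda>i. ip (w i *\<^sub>R h i) f) has_sum ip (synthesis X w h) f) X"
      unfolding synthesis_def
      by (rule has_sum_bounded_linear[OF bounded_linear_ip_left])
        (simp add: synthesis_converges(1)[OF bes that])
    then have "ip (synthesis X w h) f = (\<Sum>\<^sub>\<infinity>i\<in>X. ip (w i *\<^sub>R h i) f)"
      by (simp add: infsumI)
    also have "\<dots> = l2_ip ip X h ?g"
      unfolding l2_ip_def using that by (intro infsum_cong pointwise) (auto simp: l2_sum_def)
    finally show ?thesis .
  qed
  have unique: "g' = ?g"
    if g': "g' \<in> l2_sum X W" "\<forall>h\<in>l2_sum X W. ip (synthesis X w h) f = l2_ip ip X h g'" for g'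
  proof
    fix j
    show "g' j = ?g j"
    proof (cases "j \<in> X")
      case False
      then show ?thesis using g' by (auto simp: l2_sum_def PiE_def extensional_def)
    next
      case True
      define u where "u = g' j - ?g j"
      have uW: "u \<in> W j"
        using g'(1) g True unfolding u_def
        by (intro closed_subspaceD(5)[OF cl]) (auto simp: l2_sum_def PiE_def Pi_def)
      define h where "h = (\<lambda>i\<in>X. if i = j then u else 0)"
      have "((\<lambda>i. (norm (h i))\<^sup>2) has_sum (norm u)\<^sup>2) X"
        by (rule has_sum_finite_neutralI[of "{j}"]) (use True in \<open>auto simp: h_def\<close>)
      then have h: "h \<in> l2_sum X W"
        using uW closed_subspaceD(1)[OF cl] by (auto simp: l2_sum_def h_def summable_on_def)
      have at_j: "l2_ip ip X h k = ip u (k j)" for k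
        unfolding l2_ip_def
        by (rule infsumI, rule has_sum_finite_neutralI[of "{j}"])
          (use True in \<open>auto simp: h_def\<close>)
      have "ip u (g' j) = ip u (?g j)"
        using g'(2) h adjoint[OF h] at_j by metis
      then have "ip u u = 0"
        by (simp add: u_def ip_diff_right)
      then show ?thesis
        using ip_self_eq_0[of u] unfolding u_def by (metis eq_iff_diff_eq_0)
    qed
  qed
  show "synthesis_adj ip X W w f = ?g"
    unfolding synthesis_adj_def
    by (rule the_equality) (use g adjoint unique in blast)+
qed

lemma l2_norm_synthesis_adj_square:
  assumes "fusion_Bessel sc ip X W w B"
  shows "(l2_norm X (synthesis_adj ip X W w f))\<^sup>2
           = (\<Sum>\<^sub>\<infinity>i\<in>X. (w i)\<^sup>2 * (norm (orth_proj ip (W i) f))\<^sup>2)"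
  unfolding l2_norm_square synthesis_adj_eq(1)[OF assms]
  by (rule infsum_cong) (simp add: power_mult_distrib)

end

section \<open>The perturbation theorem\<close>

theorem theorem4p6:
  fixes sc :: "'k::rc_field \<Rightarrow> 'h::banach \<Rightarrow> 'h"
    and ip :: "'h \<Rightarrow> 'h \<Rightarrow> 'k"
    and I J :: "'i set"
    and W :: "'i \<Rightarrow> 'h set"
    and w :: "'i \<Rightarrow> real"
    and K :: "'h \<Rightarrow> 'h"
    and a b B :: real
  assumes "hilbert_space sc ip"
    and "separable_space (euclidean :: 'h topology)"
    and "fusion_Bessel sc ip I W w B"
    and "J \<subset> I"
    and "a \<ge> 0" and "b \<ge> 0"
    and "bounded_operator sc K"
    and "\<And>f. norm (adj ip K f - synthesis (I - J) w (synthesis_adj ip (I - J) W w f))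
              \<le> a * norm (adj ip K f) + b * l2_norm (I - J) (synthesis_adj ip (I - J) W w f)"
    and "a < 1"
    and "b + synthesis_norm (I - J) W w \<noteq> 0"
  shows "K_fusion_frame sc ip K (I - J) W w
           (((1 - a) / (b + synthesis_norm (I - J) W w))\<^sup>2) B"
proof -
  interpret hilbert_space sc ip by fact
  define X where "X = I - J"
  define s where "s = b + synthesis_norm X W w"
  have bes: "fusion_Bessel sc ip X W w B"
    using assms(3) by (rule fusion_Bessel_subset) (simp add: X_def)
  have s: "s > 0"
    using synthesis_norm_nonneg[OF bes] assms(6,10) unfolding s_def X_def by linarith
  have lower: "((1 - a) / s)\<^sup>2 * (norm (adj ip K f))\<^sup>2
      \<le> (\<Sum>\<^sub>\<infinity>i\<in>X. (w i)\<^sup>2 * (norm (orth_proj ip (W i) f))\<^sup>2)" for f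
  proof -
    define u where "u = adj ip K f"
    define t where "t = synthesis_adj ip X W w f"
    have "norm (synthesis X w t) \<le> synthesis_norm X W w * l2_norm X t"
      using synthesis_norm_bound[OF bes synthesis_adj_eq(2)[OF bes]]
      by (simp add: t_def synthesis_adj_eq(1)[OF bes])
    moreover have "norm u \<le> norm (u - synthesis X w t) + norm (synthesis X w t)"
      using norm_triangle_ineq[of "u - synthesis X w t" "synthesis X w t"] by simp
    moreover have "norm (u - synthesis X w t) \<le> a * norm u + b * l2_norm X t"
      unfolding u_def t_def X_def by (rule assms(8))
    ultimately have "(1 - a) * norm u \<le> s * l2_norm X t"
      by (simp add: s_def algebra_simps)
    then have "(1 - a) / s * norm u \<le> l2_norm X t"
      using s by (simp add: field_simps)
    then have "((1 - a) / s * norm u)\<^sup>2 \<le> (l2_norm X t)\<^sup>2"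
      using s assms(9) by (intro power_mono) auto
    then show ?thesis
      unfolding t_def l2_norm_synthesis_adj_square[OF bes] u_def
      by (simp only: power_mult_distrib)
  qed
  have "((1 - a) / s)\<^sup>2 > 0"
    using s assms(9) by simp
  then have "K_fusion_frame sc ip K X W w (((1 - a) / s)\<^sup>2) B"
    using bes lower unfolding K_fusion_frame_def fusion_Bessel_def by blast
  then show ?thesis
    by (simp only: s_def X_def)
qed

end
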